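(* For every $n\ge 1$, $$\sum_{\sigma\in\mathcal{S}_n(231)}a^{\operatorname{des}(\sigma)}q^{\operatorname{maj}(\sigma)}t^{\operatorname{imaj}(\sigma)}=\sum_{\sigma\in\mathcal{S}_n(312)}a^{n-1-\operatorname{des}(\sigma)}q^{\binom{n}{2}-\operatorname{maj}(\sigma)}t^{\binom{n}{2}-\operatorname{imaj}(\sigma)}$$ as polynomials in the indeterminates $a,q,t$.
   Context: $\mathcal{S}_n$ is the symmetric group on $\{1,\dots,n\}$. $\mathcal{S}_n(231)$ is the set of $\sigma\in\mathcal{S}_n$ with no $i<j<k$ satisfying $\sigma_k<\sigma_i<\sigma_j$; $\mathcal{S}_n(312)$ is the set of $\sigma\in\mathcal{S}_n$ with no $i<j<k$ satisfying $\sigma_j<\sigma_k<\sigma_i$. The descent set is $\operatorname{Des}(\sigma)=\{i : 1\le i<n,\ \sigma_i>\sigma_{i+1}\}$, $\operatorname{des}(\sigma)=|\operatorname{Des}(\sigma)|$, $\operatorname{maj}(\sigma)=\sum_{i\in\operatorname{Des}(\sigma)}i$, and $\operatorname{imaj}(\sigma)=\operatorname{maj}(\sigma^{-1})$. *)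

theory Defs
  imports "HOL-Combinatorics.Permutations" "HOL-Computational_Algebra.Polynomial"
begin

text \<open>
  A permutation of \<open>{1..n}\<close> is a function \<open>p\<close> with \<open>p permutes {1..n}\<close>; the entry
  \<open>\<sigma>\<^sub>i\<close> of its one-line notation is \<open>p i\<close>.
\<close>

definition Av231 :: "nat \<Rightarrow> (nat \<Rightarrow> nat) set" where
  "Av231 n = {p. p permutes {1..n} \<and>
     \<not> (\<exists>i j k. 1 \<le> i \<and> i < j \<and> j < k \<and> k \<le> n \<and> p k < p i \<and> p i < p j)}"

definition Av312 :: "nat \<Rightarrow> (nat \<Rightarrow> nat) set" where
  "Av312 n = {p. p permutes {1..n} \<and>
     \<not> (\<exists>i j k. 1 \<le> i \<and> i < j \<and> j < k \<and> k \<le> n \<and> p j < p k \<and> p k < p i)}"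

definition Des :: "nat \<Rightarrow> (nat \<Rightarrow> nat) \<Rightarrow> nat set" where
  "Des n p = {i. 1 \<le> i \<and> i < n \<and> p i > p (i + 1)}"

definition des :: "nat \<Rightarrow> (nat \<Rightarrow> nat) \<Rightarrow> nat" where
  "des n p = card (Des n p)"

definition maj :: "nat \<Rightarrow> (nat \<Rightarrow> nat) \<Rightarrow> nat" where
  "maj n p = (\<Sum>i\<in>Des n p. i)"

definition imaj :: "nat \<Rightarrow> (nat \<Rightarrow> nat) \<Rightarrow> nat" where
  "imaj n p = maj n (inv p)"

text \<open>
  The polynomial ring \<open>\<int>[a,q,t]\<close> is rendered as the iterated polynomial ring \<open>\<int>[a][q][t]\<close>;
  the innermost variable is \<open>a\<close>, the outermost \<open>t\<close>.
\<close>

definition var_a :: "int poly poly poly" where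
  "var_a = [:[:[:0, 1:]:]:]"

definition var_q :: "int poly poly poly" where
  "var_q = [:[:0, 1:]:]"

definition var_t :: "int poly poly poly" where
  "var_t = [:0, 1:]"

text \<open>
  The natural-number subtractions \<open>n - 1 - des n p\<close>, \<open>(n choose 2) - maj n p\<close> and
  \<open>(n choose 2) - imaj n p\<close> never truncate:
\<close>

lemma Des_subset: "Des n p \<subseteq> {1..<n}"
  by (auto simp: Des_def)

lemma des_le: "des n p \<le> n - 1"
  using card_mono[OF _ Des_subset[of n p]] by (simp add: des_def)

lemma maj_le: "maj n p \<le> n choose 2"
proof -
  have "maj n p \<le> (\<Sum>i\<in>{1..<n}. i)"
    unfolding maj_def by (rule sum_mono2) (use Des_subset[of n p] in auto)
  also have "\<dots> = n choose 2"
  proof (induction n)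
    case (Suc m)
    then show ?case
      by (cases m) (auto simp: numeral_2_eq_2)
  qed simp
  finally show ?thesis .
qed

lemma imaj_le: "imaj n p \<le> n choose 2"
  by (simp add: imaj_def maj_le)

end

theory Submission
  imports Defs
begin

text \<open>
  For a permutation \<open>p\<close> of \<open>{1..n}\<close> consider the pair \<open>(A, B) = (Des p, Des p\<^sup>-\<^sup>1)\<close>. The theorem
  follows from the fact that on the 312-avoiding permutations this pair is a complete invariant
  whose values are exactly the pairs of subsets of \<open>{1..<n}\<close> of equal size such that no initial
  segment of \<open>{1..<n}\<close> contains more elements of \<open>A\<close> than of \<open>B\<close> (lemma \<open>bij_betw_Des_pair\<close>).
  This set of pairs is invariant under \<open>(A, B) \<mapsto> ({1..<n} - B, {1..<n} - A)\<close>. Inversion exchanges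
  312-avoidance and 231-avoidance and swaps the two entries of the pair, so both sides of the
  theorem become sums over this set of pairs, and the involution carries one to the other.

  The 312-avoiding permutations are the outputs of a stack whose input is \<open>1, \<dots>, n\<close>. If \<open>M i\<close>
  is the number of items pushed before the \<open>i\<close>-th pop, then \<open>p i\<close> is the largest number in
  \<open>{1..M i}\<close> that has not been output before, and \<open>M\<close> is an arbitrary nondecreasing function with
  \<open>i \<le> M i \<le> n\<close>, in other words a Dyck path. The descents of \<open>p\<close> are the \<open>i\<close> with
  \<open>M i = M (i + 1)\<close> (two consecutive pops), and the descents of the inverse are the numbers that
  \<open>M\<close> does not attain (two consecutive pushes). So \<open>A\<close> and \<open>B\<close> record the valleys and the peaks of
  the path, and \<open>M\<close> is recovered from them by the rule that the number of elements outside \<open>A\<close>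
  below \<open>i\<close> equals the number of elements outside \<open>B\<close> below \<open>M i\<close> (lemma \<open>card_flats_misses\<close>).
\<close>

section \<open>Dyck paths as staircases\<close>

text \<open>
  A Dyck path of semilength \<open>n\<close>, given by the number \<open>M i\<close> of up steps that precede the \<open>i\<close>-th
  down step. The values of \<open>M\<close> outside \<open>{1..n}\<close> are irrelevant.
\<close>
definition staircase :: "nat \<Rightarrow> (nat \<Rightarrow> nat) \<Rightarrow> bool" where
  "staircase n M \<longleftrightarrow> (\<forall>i\<in>{1..n}. i \<le> M i \<and> M i \<le> n) \<and> (\<forall>i j. 1 \<le> i \<and> i \<le> j \<and> j \<le> n \<longrightarrow> M i \<le> M j)"

text \<open>The positions of the down steps that are followed by another down step.\<close>
definition flats :: "nat \<Rightarrow> (nat \<Rightarrow> nat) \<Rightarrow> nat set" where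
  "flats n M = {i \<in> {1..<n}. M i = M (i + 1)}"

text \<open>The positions of the up steps that are followed by another up step.\<close>
definition misses :: "nat \<Rightarrow> (nat \<Rightarrow> nat) \<Rightarrow> nat set" where
  "misses n M = {1..<n} - M ` {1..n}"

text \<open>
  The pairs of sets that arise from Dyck paths. Because of \<open>A, B \<subseteq> {1..<n}\<close>, the conditions say
  that \<open>A\<close> and \<open>B\<close> have the same size and that \<open>A\<close> has at most as many elements as \<open>B\<close> in every
  \<open>{1..<i}\<close>. Counting the complements matches the counts of peaks and valleys.
\<close>
definition ballot_pairs :: "nat \<Rightarrow> (nat set \<times> nat set) set" where
  "ballot_pairs n = {(A, B). A \<subseteq> {1..<n} \<and> B \<subseteq> {1..<n} \<and>
     (\<forall>i\<in>{1..n}. card ({1..<i} - B) \<le> card ({1..<i} - A)) \<and>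
     card ({1..<n} - B) = card ({1..<n} - A)}"

lemma staircaseD:
  assumes "staircase n M"
  shows "i \<in> {1..n} \<Longrightarrow> i \<le> M i" "i \<in> {1..n} \<Longrightarrow> M i \<le> n"
    "1 \<le> i \<Longrightarrow> i \<le> j \<Longrightarrow> j \<le> n \<Longrightarrow> M i \<le> M j"
  using assms by (auto simp: staircase_def)

lemma staircase_not_in_misses:
  "i \<in> {1..n} \<Longrightarrow> M i \<notin> misses n M"
  by (auto simp: misses_def)

text \<open>
  Each \<open>j < i\<close> outside \<open>flats\<close> is the last position at which \<open>M\<close> takes the value \<open>M j\<close>, so both
  sides count the values of \<open>M\<close> below \<open>M i\<close>.
\<close>
lemma card_flats_misses:
  assumes M: "staircase n M" and "1 \<le> i" "i \<le> n"
  shows "card ({1..<i} - flats n M) = card ({1..<M i} - misses n M)"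
  using assms(2,3)
proof (induction i rule: nat_induct_at_least)
  case base
  have "{1..<M 1} - misses n M = {}"
  proof -
    have "r \<in> misses n M" if "r \<in> {1..<M 1}" for r
    proof -
      have "r < M j" if "j \<in> {1..n}" for j
        using staircaseD(3)[OF M, of 1 j] \<open>r \<in> {1..<M 1}\<close> that by auto
      moreover have "r \<in> {1..<n}"
        using that staircaseD(2)[OF M, of 1] base by simp
      ultimately show ?thesis
        unfolding misses_def by blast
    qed
    then show ?thesis by auto
  qed
  then show ?case by (metis Diff_empty atLeastLessThan_empty card.empty empty_Diff order_refl)
next
  case (Suc i)
  have i: "i \<in> {1..n}" "i \<in> {1..<n}" "Suc i \<in> {1..n}"
    using Suc by auto
  have IH: "card ({1..<i} - flats n M) = card ({1..<M i} - misses n M)"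
    using Suc by simp
  have le: "M i \<le> M (Suc i)"
    using staircaseD(3)[OF M, of i "Suc i"] Suc by auto
  show ?case
  proof (cases "i \<in> flats n M")
    case True
    then have "{1..<Suc i} - flats n M = {1..<i} - flats n M"
      by (auto simp: less_Suc_eq)
    then show ?thesis
      using IH True by (simp add: flats_def)
  next
    case False
    then have lt: "M i < M (Suc i)"
      using le i by (auto simp: flats_def)
    have "{1..<Suc i} - flats n M = insert i ({1..<i} - flats n M)"
      using False i by auto
    then have 1: "card ({1..<Suc i} - flats n M) = Suc (card ({1..<i} - flats n M))"
      by simp
    \<comment> \<open>The values strictly between \<open>M i\<close> and \<open>M (Suc i)\<close> are all skipped.\<close>
    have skip: "r \<in> misses n M" if "M i < r" "r < M (Suc i)" for r
    proof -
      have "r \<noteq> M j" if j: "j \<in> {1..n}" for j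
      proof (cases "j \<le> i")
        case True
        then show ?thesis
          using staircaseD(3)[OF M, of j i] j i \<open>M i < r\<close> by auto
      next
        case False
        then show ?thesis
          using staircaseD(3)[OF M, of "Suc i" j] j i \<open>r < M (Suc i)\<close> by auto
      qed
      moreover have "r \<in> {1..<n}"
        using that staircaseD(2)[OF M i(3)] by simp
      ultimately show ?thesis
        unfolding misses_def by blast
    qed
    have "1 \<le> M i"
      using staircaseD(1)[OF M i(1)] i by auto
    then have "{1..<M (Suc i)} = insert (M i) ({1..<M i} \<union> {M i<..<M (Suc i)})"
      using lt by auto
    then have "{1..<M (Suc i)} - misses n M = insert (M i) ({1..<M i} - misses n M)"
      using staircase_not_in_misses[OF i(1), of M] skip by auto
    then have "card ({1..<M (Suc i)} - misses n M) = Suc (card ({1..<M i} - misses n M))"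
      by simp
    then show ?thesis
      using 1 IH by simp
  qed
qed

lemma staircase_last:
  assumes "staircase n M" "n \<ge> 1"
  shows "M n = n"
  using staircaseD(1,2)[OF assms(1), of n] assms(2) by auto

lemma flats_misses_in_ballot_pairs:
  assumes M: "staircase n M" and "n \<ge> 1"
  shows "(flats n M, misses n M) \<in> ballot_pairs n"
proof -
  have "card ({1..<i} - misses n M) \<le> card ({1..<i} - flats n M)" if "i \<in> {1..n}" for i
  proof -
    have "card ({1..<i} - misses n M) \<le> card ({1..<M i} - misses n M)"
      using staircaseD(1)[OF M that] by (intro card_mono) auto
    then show ?thesis
      using card_flats_misses[OF M, of i] that by simp
  qed
  moreover have "card ({1..<n} - misses n M) = card ({1..<n} - flats n M)"
    using card_flats_misses[OF M, of n] staircase_last[OF M] \<open>n \<ge> 1\<close> by simp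
  ultimately show ?thesis
    by (auto simp: ballot_pairs_def flats_def misses_def)
qed

lemma staircase_eqI:
  assumes M: "staircase n M" and M': "staircase n M'"
    and flats: "flats n M = flats n M'" and misses: "misses n M = misses n M'"
    and i: "i \<in> {1..n}"
  shows "M i = M' i"
proof -
  have False if "staircase n K" "staircase n L" "flats n K = flats n L" "misses n K = misses n L"
    "K i < L i" for K L
  proof -
    have "K i \<ge> 1"
      using staircaseD(1)[OF that(1) i] i by auto
    then have "{1..<K i} - misses n K \<subset> {1..<L i} - misses n L"
      using that(4,5) staircase_not_in_misses[OF i, of K] by force
    then have "card ({1..<K i} - misses n K) < card ({1..<L i} - misses n L)"
      by (intro psubset_card_mono) auto
    then show False
      using card_flats_misses[OF that(1), of i] card_flats_misses[OF that(2), of i] that(3) i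
      by simp
  qed
  then show ?thesis
    using assms by (metis nat_neq_iff)
qed

lemma ex_staircase:
  assumes AB: "(A, B) \<in> ballot_pairs n" and n: "n \<ge> 1"
  shows "\<exists>M. staircase n M \<and> flats n M = A \<and> misses n M = B"
proof -
  define c where "c i = card ({1..<i} - A)" for i
  define d where "d r = card ({1..<r} - B)" for r
  have A: "A \<subseteq> {1..<n}" and B: "B \<subseteq> {1..<n}"
    and dc: "\<And>i. i \<in> {1..n} \<Longrightarrow> d i \<le> c i" and dcn: "d n = c n"
    using AB by (auto simp: ballot_pairs_def c_def d_def)
  have c_mono: "c i \<le> c j" if "i \<le> j" for i j
    unfolding c_def using that by (intro card_mono) auto
  have d_mono: "d i \<le> d j" if "i \<le> j" for i j
    unfolding d_def using that by (intro card_mono) auto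
  have c_Suc: "c (Suc i) = (if i \<in> A then c i else Suc (c i))" if "i \<ge> 1" for i
  proof -
    have "{1..<Suc i} - A = (if i \<in> A then {1..<i} - A else insert i ({1..<i} - A))"
      using that by (auto simp: less_Suc_eq)
    then show ?thesis
      by (simp add: c_def)
  qed
  have d_Suc: "d (Suc i) = (if i \<in> B then d i else Suc (d i))" if "i \<ge> 1" for i
  proof -
    have "{1..<Suc i} - B = (if i \<in> B then {1..<i} - B else insert i ({1..<i} - B))"
      using that by (auto simp: less_Suc_eq)
    then show ?thesis
      by (simp add: d_def)
  qed
  \<comment> \<open>\<open>M i\<close> is the element of \<open>{1..n} - B\<close> with exactly \<open>c i\<close> smaller elements of that set.\<close>
  define M where "M i = (LEAST r. c i < d (Suc r))" for i
  have ex: "c i < d (Suc n)" if "i \<in> {1..n}" for i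
  proof -
    have "n \<notin> B"
      using B by auto
    then show ?thesis
      using d_Suc[OF n] dcn c_mono[of i n] that by auto
  qed
  have M_gt: "c i < d (Suc (M i))" if "i \<in> {1..n}" for i
    unfolding M_def using ex[OF that] by (rule LeastI)
  have M_le: "M i \<le> r" if "c i < d (Suc r)" for i r
    unfolding M_def using that by (rule Least_le)
  have M_ge: "i \<le> M i" if "i \<in> {1..n}" for i
  proof (rule ccontr)
    assume "\<not> i \<le> M i"
    then have "d (Suc (M i)) \<le> d i"
      by (intro d_mono) auto
    then show False
      using dc[OF that] M_gt[OF that] by simp
  qed
  have M_mono: "M i \<le> M j" if "1 \<le> i" "i \<le> j" "j \<le> n" for i j
    by (rule M_le, rule le_less_trans[OF c_mono[OF \<open>i \<le> j\<close>] M_gt]) (use that in auto)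
  have M: "staircase n M"
    unfolding staircase_def using M_ge M_le[OF ex] M_mono by blast
  have M_spec: "M i \<notin> B \<and> d (M i) = c i" if "i \<in> {1..n}" for i
  proof -
    have pos: "M i \<ge> 1"
      using M_ge[OF that] that by auto
    then have "\<not> c i < d (Suc (M i - 1))"
      using M_le[of i "M i - 1"] by auto
    then have "d (M i) \<le> c i"
      using pos by simp
    then show ?thesis
      using M_gt[OF that] d_Suc[OF pos] by (auto split: if_splits)
  qed
  have flats: "flats n M = A"
  proof -
    have "M i = M (i + 1) \<longleftrightarrow> i \<in> A" if "i \<in> {1..<n}" for i
    proof
      assume "M i = M (i + 1)"
      then have "c i = c (i + 1)"
        using M_spec[of i] M_spec[of "i + 1"] that by auto
      then show "i \<in> A"
        using c_Suc[of i] that by (auto split: if_splits)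
    next
      assume "i \<in> A"
      then have "c (i + 1) = c i"
        using c_Suc[of i] that by auto
      then show "M i = M (i + 1)"
        by (simp add: M_def)
    qed
    then show ?thesis
      using A by (auto simp: flats_def)
  qed
  have "B \<subseteq> misses n M"
    using B M_spec by (auto simp: misses_def)
  moreover have "card ({1..<n} - misses n M) = card ({1..<n} - B)"
    using flats_misses_in_ballot_pairs[OF M n] dcn flats
    by (auto simp: ballot_pairs_def c_def d_def)
  moreover have "misses n M \<subseteq> {1..<n}"
    by (auto simp: misses_def)
  ultimately have "{1..<n} - misses n M = {1..<n} - B"
    by (intro card_subset_eq) auto
  then have "misses n M = B"
    using B \<open>misses n M \<subseteq> {1..<n}\<close> by blast
  then show ?thesis
    using M flats by blast
qed

text \<open>The involution that exchanges the two sides of the theorem.\<close>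
lemma ballot_pairs_complement:
  assumes "(A, B) \<in> ballot_pairs n"
  shows "({1..<n} - B, {1..<n} - A) \<in> ballot_pairs n"
proof -
  have compl: "card ({1..<i} - ({1..<n} - X)) + card ({1..<i} - X) = i - 1" if "i \<le> n" for i X
  proof -
    have "{1..<i} = ({1..<i} - ({1..<n} - X)) \<union> ({1..<i} - X)"
      using that by auto
    then have "card {1..<i} = card (({1..<i} - ({1..<n} - X)) \<union> ({1..<i} - X))"
      by simp
    also have "\<dots> = card ({1..<i} - ({1..<n} - X)) + card ({1..<i} - X)"
      using that by (intro card_Un_disjoint) auto
    finally show ?thesis
      by simp
  qed
  have "card ({1..<i} - ({1..<n} - A)) \<le> card ({1..<i} - ({1..<n} - B))" if "i \<in> {1..n}" for i
  proof -
    have "card ({1..<i} - B) \<le> card ({1..<i} - A)"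
      using assms that by (auto simp: ballot_pairs_def)
    then show ?thesis
      using compl[of i A] compl[of i B] that by simp
  qed
  moreover have "card ({1..<n} - ({1..<n} - A)) = card ({1..<n} - ({1..<n} - B))"
    using assms compl[of n A] compl[of n B] by (auto simp: ballot_pairs_def)
  ultimately show ?thesis
    by (auto simp: ballot_pairs_def)
qed

section \<open>Stack outputs and 312-avoiding permutations\<close>

text \<open>
  The output of a stack with input \<open>1, 2, \<dots>\<close>: before the \<open>i\<close>-th pop the numbers \<open>1, \<dots>, M i\<close> have
  been pushed, and the item popped is the largest one that is still present.
\<close>
fun stack_output :: "(nat \<Rightarrow> nat) \<Rightarrow> nat \<Rightarrow> nat" where
  "stack_output M i = Max ({1..M i} - stack_output M ` {1..<i})"

declare stack_output.simps [simp del]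

text \<open>The permutation \<open>p\<close> is produced by a stack according to the staircase \<open>M\<close>.\<close>
definition stack_sequence :: "nat \<Rightarrow> (nat \<Rightarrow> nat) \<Rightarrow> (nat \<Rightarrow> nat) \<Rightarrow> bool" where
  "stack_sequence n M p \<longleftrightarrow> staircase n M \<and> p permutes {1..n} \<and>
     (\<forall>i\<in>{1..n}. p i = Max ({1..M i} - p ` {1..<i}))"

text \<open>A pop never fails: before the \<open>i\<close>-th one, at least \<open>i\<close> items have entered and fewer have left.\<close>
lemma stack_nonempty:
  assumes "staircase n M" "i \<in> {1..n}"
  shows "{1..M i} - f ` {1..<i} \<noteq> {}"
proof
  assume "{1..M i} - f ` {1..<i} = {}"
  then have "{1..M i} \<subseteq> f ` {1..<i}"
    by auto
  then have "card {1..M i} \<le> card (f ` {1..<i})"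
    by (intro card_mono) auto
  also have "\<dots> \<le> i - 1"
    using card_image_le[of "{1..<i}" f] by simp
  finally show False
    using staircaseD(1)[OF assms] assms(2) by auto
qed

lemma stack_sequence_props:
  assumes "stack_sequence n M p" "i \<in> {1..n}"
  shows "1 \<le> p i" "p i \<le> M i" "\<And>r. 1 \<le> r \<Longrightarrow> r \<le> M i \<Longrightarrow> r \<notin> p ` {1..<i} \<Longrightarrow> r \<le> p i"
proof -
  have eq: "p i = Max ({1..M i} - p ` {1..<i})" and M: "staircase n M"
    using assms by (auto simp: stack_sequence_def)
  have "p i \<in> {1..M i} - p ` {1..<i}"
    using stack_nonempty[OF M assms(2)] unfolding eq by (intro Max_in) auto
  then show "1 \<le> p i" "p i \<le> M i"
    by auto
  show "r \<le> p i" if "1 \<le> r" "r \<le> M i" "r \<notin> p ` {1..<i}" for r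
    unfolding eq using that by (intro Max_ge) auto
qed

lemma stack_sequence_in_Av312:
  assumes p: "stack_sequence n M p"
  shows "p \<in> Av312 n"
proof -
  have perm: "p permutes {1..n}" and M: "staircase n M"
    using p by (auto simp: stack_sequence_def)
  have False if ijk: "1 \<le> i" "i < j" "j < k" "k \<le> n" "p j < p k" "p k < p i" for i j k
  proof -
    \<comment> \<open>At the \<open>j\<close>-th pop the larger item \<open>p k\<close> is already on the stack.\<close>
    have "p k \<le> M j"
      using stack_sequence_props(2)[OF p, of i] staircaseD(3)[OF M, of i j] ijk by simp
    moreover have "p k \<notin> p ` {1..<j}"
      using inj_image_mem_iff[OF permutes_inj[OF perm]] ijk by simp
    moreover have "1 \<le> p k"
      using stack_sequence_props(1)[OF p, of k] ijk by simp
    ultimately show False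
      using stack_sequence_props(3)[OF p, of j "p k"] ijk by simp
  qed
  then show ?thesis
    using perm unfolding Av312_def by blast
qed

text \<open>The number of items pushed before the \<open>i\<close>-th pop is the largest entry among the first \<open>i\<close>.\<close>
lemma Av312_stack_sequence:
  assumes p: "p \<in> Av312 n"
  shows "stack_sequence n (\<lambda>i. Max (p ` {1..i})) p"
proof -
  define M where "M i = Max (p ` {1..i})" for i
  have perm: "p permutes {1..n}"
    and av: "\<And>i j k. 1 \<le> i \<Longrightarrow> i < j \<Longrightarrow> j < k \<Longrightarrow> k \<le> n \<Longrightarrow> p j < p k \<Longrightarrow> p k < p i \<Longrightarrow> False"
    using p unfolding Av312_def by blast+
  have inj: "p i = p j \<longleftrightarrow> i = j" for i j
    using inj_eq[OF permutes_inj[OF perm]] .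
  have range: "p i \<in> {1..n}" if "i \<in> {1..n}" for i
    using permutes_in_image[OF perm] that by blast
  have M_in: "M i \<in> p ` {1..i}" if "i \<ge> 1" for i
    unfolding M_def using that by (intro Max_in) auto
  have M_ge: "p j \<le> M i" if "1 \<le> j" "j \<le> i" for i j
    unfolding M_def using that by (intro Max_ge) auto
  have "staircase n M"
    unfolding staircase_def
  proof (intro conjI ballI allI impI)
    fix i assume i: "i \<in> {1..n}"
    have "p ` {1..i} \<subseteq> {1..M i}"
      using range M_ge i by fastforce
    then have "card (p ` {1..i}) \<le> card {1..M i}"
      by (intro card_mono) auto
    moreover have "card (p ` {1..i}) = i"
      using card_image[of p "{1..i}"] inj by (auto simp: inj_on_def)
    ultimately show "i \<le> M i"
      by simp
    show "M i \<le> n"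
      using M_in[of i] range i by fastforce
  next
    fix i j assume "1 \<le> i \<and> i \<le> j \<and> j \<le> n"
    then show "M i \<le> M j"
      unfolding M_def by (intro Max_mono) auto
  qed
  moreover have "p i = Max ({1..M i} - p ` {1..<i})" if i: "i \<in> {1..n}" for i
  proof (rule sym, rule Max_eqI)
    show "p i \<in> {1..M i} - p ` {1..<i}"
      using range[OF i] M_ge[of i i] inj i by auto
  next
    fix r assume r: "r \<in> {1..M i} - p ` {1..<i}"
    show "r \<le> p i"
    proof (rule ccontr)
      assume less: "\<not> r \<le> p i"
      obtain h where h: "h \<in> {1..i}" "M i = p h"
        using M_in[of i] i by auto
      have "r \<in> {1..n}"
        using r h range[of h] i by auto
      then obtain k where k: "k \<in> {1..n}" "p k = r"
        using permutes_image[OF perm] by (metis imageE)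
      have "i < k"
        using r k less by (cases k i rule: linorder_cases) auto
      moreover have "r < p h"
        using r h k \<open>i < k\<close> inj[of k h] by (auto simp: le_less)
      moreover have "h < i"
        using h less r by (cases "h = i") auto
      \<comment> \<open>The entries at positions \<open>h < i < k\<close> form the pattern 312.\<close>
      ultimately show False
        using av[of h i k] h k less by auto
    qed
  qed simp
  ultimately show ?thesis
    using perm unfolding stack_sequence_def M_def by blast
qed

lemma ex_stack_sequence:
  assumes M: "staircase n M"
  shows "\<exists>p. stack_sequence n M p"
proof -
  define p where "p i = (if i \<in> {1..n} then stack_output M i else i)" for i
  have p_image: "p ` {1..<i} = stack_output M ` {1..<i}" if "i \<in> {1..n}" for i
    using that by (intro image_cong) (auto simp: p_def)
  have p_eq: "p i = Max ({1..M i} - p ` {1..<i})" if "i \<in> {1..n}" for i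
  proof -
    have "p i = stack_output M i"
      using that by (simp add: p_def)
    also have "\<dots> = Max ({1..M i} - stack_output M ` {1..<i})"
      by (rule stack_output.simps)
    finally show ?thesis
      using p_image[OF that] by simp
  qed
  have p_in: "p i \<in> {1..M i} - p ` {1..<i}" if "i \<in> {1..n}" for i
    using stack_nonempty[OF M that] unfolding p_eq[OF that] by (intro Max_in) auto
  have "inj_on p {1..n}"
  proof (rule linorder_inj_onI)
    fix i j assume "i < j" "i \<in> {1..n}" "j \<in> {1..n}"
    moreover from this have "p i \<in> p ` {1..<j}"
      by simp
    ultimately show "p i \<noteq> p j"
      using p_in[of j] by force
  qed auto
  moreover have "p ` {1..n} \<subseteq> {1..n}"
    using p_in staircaseD(2)[OF M] by fastforce
  ultimately have "bij_betw p {1..n} {1..n}"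
    by (simp add: bij_betw_def endo_inj_surj)
  then have "p permutes {1..n}"
    by (rule bij_imp_permutes) (auto simp: p_def)
  then show ?thesis
    using M p_eq unfolding stack_sequence_def by blast
qed

lemma stack_sequence_unique:
  assumes p: "stack_sequence n M p" and p': "stack_sequence n M' p'"
    and eq: "\<And>i. i \<in> {1..n} \<Longrightarrow> M i = M' i"
  shows "p = p'"
proof
  fix i
  show "p i = p' i"
  proof (cases "i \<in> {1..n}")
    case True
    then show ?thesis
    proof (induction i rule: less_induct)
      case (less i)
      have "p ` {1..<i} = p' ` {1..<i}"
        using less by (intro image_cong) auto
      then show ?case
        using p p' less.prems eq[OF less.prems] by (simp add: stack_sequence_def)
    qed
  next
    case False
    have "p permutes {1..n}" "p' permutes {1..n}"
      using p p' by (auto simp: stack_sequence_def)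
    then show ?thesis
      using False by (simp add: permutes_not_in)
  qed
qed

section \<open>Descents of stack outputs\<close>

text \<open>If some push immediately precedes the \<open>i\<close>-th pop, the last number pushed is popped at once.\<close>
lemma stack_sequence_record:
  assumes p: "stack_sequence n M p" and i: "i \<in> {1..n}"
    and new: "\<And>j. 1 \<le> j \<Longrightarrow> j < i \<Longrightarrow> M j < M i"
  shows "p i = M i"
proof -
  have M: "staircase n M"
    using p by (simp add: stack_sequence_def)
  have "M i \<notin> p ` {1..<i}"
    using stack_sequence_props(2)[OF p] new i by fastforce
  moreover have "1 \<le> M i"
    using staircaseD(1)[OF M i] i by auto
  ultimately show ?thesis
    using stack_sequence_props(2,3)[OF p i] by (simp add: le_antisym)
qed

lemma Des_stack_sequence:
  assumes p: "stack_sequence n M p"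
  shows "Des n p = flats n M"
proof -
  have M: "staircase n M" and perm: "p permutes {1..n}"
    using p by (auto simp: stack_sequence_def)
  have "p (i + 1) < p i \<longleftrightarrow> M i = M (i + 1)" if i: "i \<in> {1..<n}" for i
  proof (cases "M i = M (i + 1)")
    case True
    \<comment> \<open>The item popped next was already present at the \<open>i\<close>-th pop.\<close>
    have "p (i + 1) \<notin> p ` {1..<i}"
      using inj_image_mem_iff[OF permutes_inj[OF perm]] by simp
    then have "p (i + 1) \<le> p i"
      using stack_sequence_props[OF p, of "i + 1"] stack_sequence_props(3)[OF p, of i "p (i + 1)"]
        True i by simp
    moreover have "p (i + 1) \<noteq> p i"
      using inj_eq[OF permutes_inj[OF perm]] by simp
    ultimately show ?thesis
      using True by simp
  next
    case False
    then have lt: "M i < M (i + 1)"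
      using staircaseD(3)[OF M, of i "i + 1"] i by auto
    have "p (i + 1) = M (i + 1)"
    proof (rule stack_sequence_record[OF p])
      show "M j < M (i + 1)" if "1 \<le> j" "j < i + 1" for j
        using staircaseD(3)[OF M, of j i] that i lt by auto
    qed (use i in auto)
    then show ?thesis
      using stack_sequence_props(2)[OF p, of i] i lt by auto
  qed
  then show ?thesis
    by (auto simp: Des_def flats_def)
qed

lemma Des_inv_stack_sequence:
  assumes p: "stack_sequence n M p"
  shows "Des n (inv p) = misses n M"
proof -
  have M: "staircase n M" and perm: "p permutes {1..n}"
    using p by (auto simp: stack_sequence_def)
  have p_inv: "p (inv p r) = r" "inv p (p r) = r" for r
    using permutes_inverses[OF perm] by auto
  have inv_in: "inv p r \<in> {1..n}" if "r \<in> {1..n}" for r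
    using permutes_in_image[OF permutes_inv[OF perm]] that by blast
  have "inv p (r + 1) < inv p r \<longleftrightarrow> r \<notin> M ` {1..n}" if r: "r \<in> {1..<n}" for r
  proof (cases "r \<in> M ` {1..n}")
    case True
    \<comment> \<open>At the first pop with \<open>M i = r\<close> the item \<open>r\<close> comes out, before \<open>r + 1\<close> has been pushed.\<close>
    define i where "i = (LEAST i. i \<in> {1..n} \<and> M i = r)"
    have i: "i \<in> {1..n}" "M i = r"
      using True LeastI_ex[of "\<lambda>i. i \<in> {1..n} \<and> M i = r"] unfolding i_def by blast+
    have "p i = M i"
    proof (rule stack_sequence_record[OF p i(1)])
      fix j assume j: "1 \<le> j" "j < i"
      then have "M j \<noteq> r"
        using not_less_Least[of j "\<lambda>i. i \<in> {1..n} \<and> M i = r"] i unfolding i_def by auto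
      then show "M j < M i"
        using staircaseD(3)[OF M, of j i] i j by auto
    qed
    then have "inv p r = i"
      using p_inv(2)[of i] i by simp
    moreover have "\<not> inv p (r + 1) < i"
    proof
      assume less: "inv p (r + 1) < i"
      have k: "inv p (r + 1) \<in> {1..n}"
        using inv_in r by auto
      then have "r + 1 \<le> M (inv p (r + 1))"
        using stack_sequence_props(2)[OF p k] p_inv(1) by simp
      also have "\<dots> \<le> M i"
        using staircaseD(3)[OF M, of "inv p (r + 1)" i] less k i by auto
      finally show False
        using i by simp
    qed
    ultimately show ?thesis
      using True by simp
  next
    case False
    define k where "k = inv p r"
    have k: "k \<in> {1..n}" "p k = r"
      using inv_in r p_inv unfolding k_def by auto
    \<comment> \<open>When \<open>r\<close> is popped, \<open>r + 1\<close> has already been pushed, hence also popped.\<close>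
    have "r < M k"
      using stack_sequence_props(2)[OF p k(1)] False k by (metis imageI le_neq_implies_less)
    then have "r + 1 \<in> p ` {1..<k}"
      using stack_sequence_props(3)[OF p k(1), of "r + 1"] k by auto
    then have "inv p (r + 1) < k"
      using p_inv(2) by auto
    then show ?thesis
      using False by (simp add: k_def)
  qed
  then show ?thesis
    by (auto simp: Des_def misses_def)
qed

text \<open>
  The 312-avoiding permutations correspond bijectively to the Dyck paths, and a Dyck path is
  determined by its \<open>flats\<close> and \<open>misses\<close>, which can form any ballot pair.
\<close>
lemma bij_betw_Des_pair:
  assumes n: "n \<ge> 1"
  shows "bij_betw (\<lambda>p. (Des n p, Des n (inv p))) (Av312 n) (ballot_pairs n)"
  unfolding bij_betw_def
proof
  show "inj_on (\<lambda>p. (Des n p, Des n (inv p))) (Av312 n)"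
  proof (rule inj_onI)
    fix p p' assume "p \<in> Av312 n" "p' \<in> Av312 n"
      and eq: "(Des n p, Des n (inv p)) = (Des n p', Des n (inv p'))"
    then obtain M M' where M: "stack_sequence n M p" and M': "stack_sequence n M' p'"
      using Av312_stack_sequence by blast
    have "flats n M = flats n M'" "misses n M = misses n M'"
      using eq Des_stack_sequence[OF M] Des_stack_sequence[OF M']
        Des_inv_stack_sequence[OF M] Des_inv_stack_sequence[OF M'] by auto
    then show "p = p'"
      using stack_sequence_unique[OF M M'] staircase_eqI[of n M M'] M M'
      by (auto simp: stack_sequence_def)
  qed
  show "(\<lambda>p. (Des n p, Des n (inv p))) ` Av312 n = ballot_pairs n"
  proof (intro equalityI subsetI)
    fix P assume "P \<in> (\<lambda>p. (Des n p, Des n (inv p))) ` Av312 n"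
    then obtain p where p: "p \<in> Av312 n" "P = (Des n p, Des n (inv p))"
      by auto
    obtain M where M: "stack_sequence n M p"
      using Av312_stack_sequence[OF p(1)] by blast
    then have "staircase n M"
      by (simp add: stack_sequence_def)
    then show "P \<in> ballot_pairs n"
      using flats_misses_in_ballot_pairs[OF _ n] p(2)
        Des_stack_sequence[OF M] Des_inv_stack_sequence[OF M] by simp
  next
    fix P assume "P \<in> ballot_pairs n"
    then obtain M where M: "staircase n M" "P = (flats n M, misses n M)"
      using ex_staircase[of "fst P" "snd P", OF _ n] by (cases P) auto
    then obtain p where p: "stack_sequence n M p"
      using ex_stack_sequence by blast
    then have "P = (Des n p, Des n (inv p))"
      using M(2) Des_stack_sequence Des_inv_stack_sequence by simp
    then show "P \<in> (\<lambda>p. (Des n p, Des n (inv p))) ` Av312 n"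
      using stack_sequence_in_Av312[OF p] by blast
  qed
qed

section \<open>Inversion and complementation\<close>

lemma inv_Av312:
  assumes "p \<in> Av312 n"
  shows "inv p \<in> Av231 n"
proof -
  have perm: "p permutes {1..n}"
    and av: "\<And>i j k. 1 \<le> i \<Longrightarrow> i < j \<Longrightarrow> j < k \<Longrightarrow> k \<le> n \<Longrightarrow> p j < p k \<Longrightarrow> p k < p i \<Longrightarrow> False"
    using assms unfolding Av312_def by blast+
  have False if "1 \<le> i" "i < j" "j < k" "k \<le> n" "inv p k < inv p i" "inv p i < inv p j" for i j k
  proof (rule av[of "inv p k" "inv p i" "inv p j"])
    have in_range: "inv p r \<in> {1..n}" if "r \<in> {1..n}" for r
      using permutes_in_image[OF permutes_inv[OF perm]] that by blast
    show "1 \<le> inv p k" "inv p j \<le> n"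
      using in_range[of k] in_range[of j] that by auto
  qed (use that permutes_inverses(1)[OF perm] in auto)
  then show ?thesis
    using permutes_inv[OF perm] unfolding Av231_def by blast
qed

lemma inv_Av231:
  assumes "p \<in> Av231 n"
  shows "inv p \<in> Av312 n"
proof -
  have perm: "p permutes {1..n}"
    and av: "\<And>i j k. 1 \<le> i \<Longrightarrow> i < j \<Longrightarrow> j < k \<Longrightarrow> k \<le> n \<Longrightarrow> p k < p i \<Longrightarrow> p i < p j \<Longrightarrow> False"
    using assms unfolding Av231_def by blast+
  have False if "1 \<le> i" "i < j" "j < k" "k \<le> n" "inv p j < inv p k" "inv p k < inv p i" for i j k
  proof (rule av[of "inv p j" "inv p k" "inv p i"])
    have in_range: "inv p r \<in> {1..n}" if "r \<in> {1..n}" for r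
      using permutes_in_image[OF permutes_inv[OF perm]] that by blast
    show "1 \<le> inv p j" "inv p i \<le> n"
      using in_range[of j] in_range[of i] that by auto
  qed (use that permutes_inverses(1)[OF perm] in auto)
  then show ?thesis
    using permutes_inv[OF perm] unfolding Av312_def by blast
qed

lemma inv_inv_Av312: "p \<in> Av312 n \<Longrightarrow> inv (inv p) = p"
  by (auto simp: Av312_def permutes_inv_inv)

lemma inv_inv_Av231: "p \<in> Av231 n \<Longrightarrow> inv (inv p) = p"
  by (auto simp: Av231_def permutes_inv_inv)

lemma sum_complement:
  assumes "A \<subseteq> {1..<n}"
  shows "\<Sum>({1..<n} - A) = (n choose 2) - \<Sum>A"
proof -
  have "{1..<n} = {0..n - 1} - {0}"
    by auto
  then have "\<Sum>{1..<n} = \<Sum>{0..n - 1}"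
    by (simp add: sum_diff1_nat)
  then have "\<Sum>{1..<n} = n choose 2"
    by (simp add: gauss_sum_nat choose_two mult.commute) (cases n, auto)
  moreover have "finite A"
    using assms finite_subset by blast
  ultimately show ?thesis
    using sum_diff_nat[OF _ assms, of "\<lambda>i. i"] by simp
qed

theorem theorem4p4:
  fixes n :: nat
  assumes "n \<ge> 1"
  shows "(\<Sum>p\<in>Av231 n. var_a ^ des n p * var_q ^ maj n p * var_t ^ imaj n p)
       = (\<Sum>p\<in>Av312 n. var_a ^ (n - 1 - des n p) * var_q ^ ((n choose 2) - maj n p)
                          * var_t ^ ((n choose 2) - imaj n p))"
proof -
  define w where "w = (\<lambda>(A, B). var_a ^ card B * var_q ^ \<Sum>B * var_t ^ \<Sum>A)"
  define w' where "w' = (\<lambda>(A, B). var_a ^ (n - 1 - card A) * var_q ^ ((n choose 2) - \<Sum>A)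
                                  * var_t ^ ((n choose 2) - \<Sum>B))"
  have "(\<Sum>p\<in>Av231 n. var_a ^ des n p * var_q ^ maj n p * var_t ^ imaj n p)
      = (\<Sum>p\<in>Av312 n. w (Des n p, Des n (inv p)))"
    by (rule sum.reindex_bij_witness[of _ inv inv])
      (auto simp: inv_Av312 inv_Av231 inv_inv_Av312 inv_inv_Av231 w_def des_def maj_def imaj_def)
  also have "\<dots> = (\<Sum>P\<in>ballot_pairs n. w P)"
    using bij_betw_Des_pair[OF assms] by (rule sum.reindex_bij_betw)
  also have "\<dots> = (\<Sum>P\<in>ballot_pairs n. w' P)"
  proof (rule sum.reindex_bij_witness[of _ "\<lambda>(A, B). ({1..<n} - B, {1..<n} - A)"
        "\<lambda>(A, B). ({1..<n} - B, {1..<n} - A)"])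
    fix P assume P: "P \<in> ballot_pairs n"
    obtain A B where AB: "P = (A, B)"
      by (cases P)
    have sub: "A \<subseteq> {1..<n}" "B \<subseteq> {1..<n}"
      using P AB by (auto simp: ballot_pairs_def)
    show "(case case P of (A, B) \<Rightarrow> ({1..<n} - B, {1..<n} - A) of
           (A, B) \<Rightarrow> ({1..<n} - B, {1..<n} - A)) = P"
      using sub AB by auto
    then show "(case case P of (A, B) \<Rightarrow> ({1..<n} - B, {1..<n} - A) of
           (A, B) \<Rightarrow> ({1..<n} - B, {1..<n} - A)) = P" .
    show "(case P of (A, B) \<Rightarrow> ({1..<n} - B, {1..<n} - A)) \<in> ballot_pairs n"
      using P AB ballot_pairs_complement by simp
    then show "(case P of (A, B) \<Rightarrow> ({1..<n} - B, {1..<n} - A)) \<in> ballot_pairs n" .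
    have compl: "n - 1 - card ({1..<n} - X) = card X"
      "(n choose 2) - \<Sum>({1..<n} - X) = \<Sum>X" if "X \<subseteq> {1..<n}" for X
    proof -
      have eq: "{1..<n} - ({1..<n} - X) = X"
        using that by auto
      show "n - 1 - card ({1..<n} - X) = card X"
        using card_Diff_subset[of "{1..<n} - X" "{1..<n}"] eq by auto
      show "(n choose 2) - \<Sum>({1..<n} - X) = \<Sum>X"
        using sum_complement[of "{1..<n} - X" n] eq by simp
    qed
    show "w' (case P of (A, B) \<Rightarrow> ({1..<n} - B, {1..<n} - A)) = w P"
      using AB compl sub by (simp add: w_def w'_def)
  qed
  also have "\<dots> = (\<Sum>p\<in>Av312 n. w' (Des n p, Des n (inv p)))"
    using bij_betw_Des_pair[OF assms] by (rule sum.reindex_bij_betw[symmetric])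
  also have "\<dots> = (\<Sum>p\<in>Av312 n. var_a ^ (n - 1 - des n p) * var_q ^ ((n choose 2) - maj n p)
                          * var_t ^ ((n choose 2) - imaj n p))"
    by (simp add: w'_def des_def maj_def imaj_def)
  finally show ?thesis .
qed

end
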